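(* Let $K\subset\mathbb{R}^2$ be a bounded convex set, symmetric with respect to the origin, and let $S\subset\mathbb{R}^2$ be well-distributed. Suppose that the $K$-distance set $\Delta_K(S)$ is separated. Then $K$ is a polygon with finitely many sides.
   Context: A set $A\subset\mathbb{R}^d$ is separated if there exists $c>0$ such that $\|a-b\|\ge c$ for all $a,b\in A$ with $a\neq b$, where $\|\cdot\|$ is the Euclidean norm (for $A\subset\mathbb{R}$ this is the absolute value). A set $S\subset\mathbb{R}^2$ is well-distributed if there exists $C>0$ such that every square of side-length $C$ contains at least one element of $S$. For $x,y\in\mathbb{R}^2$ the $K$-distance is $\|x-y\|_K=\inf\{t: x-y\in tK\}$, and $\Delta_K(S)=\{\|x-y\|_K: x,y\in S\}\subset\mathbb{R}$. *)

theory Defs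
  imports "HOL-Analysis.Analysis"
begin

text \<open>
  A set \<open>A\<close> is separated (there is \<open>c > 0\<close> with \<open>dist a b \<ge> c\<close> for all distinct \<open>a, b \<in> A\<close>)
  iff \<^const>\<open>uniform_discrete\<close> \<open>A\<close>; this is the definition of the latter, read contrapositively.
\<close>

text \<open>Squares are closed and may have any orientation: \<open>u, v\<close> is an arbitrary orthonormal frame.\<close>

definition is_square :: "real \<Rightarrow> (real ^ 2) set \<Rightarrow> bool" where
  "is_square C Q \<longleftrightarrow>
     (\<exists>p u v. norm u = 1 \<and> norm v = 1 \<and> u \<bullet> v = 0 \<and>
        Q = {p + s *\<^sub>R u + t *\<^sub>R v | s t. 0 \<le> s \<and> s \<le> C \<and> 0 \<le> t \<and> t \<le> C})"

definition well_distributed :: "(real ^ 2) set \<Rightarrow> bool" where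
  "well_distributed S \<longleftrightarrow> (\<exists>C>0. \<forall>Q. is_square C Q \<longrightarrow> Q \<inter> S \<noteq> {})"

text \<open>
  The parameter \<open>t\<close> has to be restricted to \<open>t \<ge> 0\<close>, since \<open>t K = (- t) K\<close> for symmetric \<open>K\<close>.
  The infimum is taken in \<^typ>\<open>ereal\<close>, so that it is \<open>\<infinity>\<close> (and not an unspecified real number)
  when no multiple of \<open>K\<close> contains \<open>x - y\<close>.
\<close>

definition K_dist :: "(real ^ 2) set \<Rightarrow> real ^ 2 \<Rightarrow> real ^ 2 \<Rightarrow> ereal" where
  "K_dist K x y = Inf {ereal t | t. 0 \<le> t \<and> x - y \<in> (\<lambda>z. t *\<^sub>R z) ` K}"

definition K_distance_set :: "(real ^ 2) set \<Rightarrow> (real ^ 2) set \<Rightarrow> ereal set" where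
  "K_distance_set K S = {K_dist K x y | x y. x \<in> S \<and> y \<in> S}"

text \<open>
  A closed, nondegenerate (two-dimensional) convex polygon; its sides are its facets.
\<close>

definition convex_polygon :: "(real ^ 2) set \<Rightarrow> bool" where
  "convex_polygon P \<longleftrightarrow> polytope P \<and> aff_dim P = 2"

end

theory Submission
  imports Defs
begin

text \<open>
  Let \<open>N\<close> be the norm with unit ball \<open>closure K\<close>, and suppose that the ball has infinitely many
  extreme points. Some of them, \<open>f n\<close>, accumulate at a point \<open>e\<close> along a tangential direction \<open>u\<close>,
  and all subgradients of \<open>N\<close> at points close enough to the \<open>f n\<close> converge to the functional \<open>h\<close> with
  \<open>h \<bullet> e = 1\<close> and \<open>h \<bullet> u = 0\<close>. By the pigeonhole principle there are \<open>x \<noteq> x'\<close> in \<open>S\<close> for which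
  \<open>\<bar>h \<bullet> (x' - x)\<bar>\<close> is less than the separation constant \<open>c\<close>. Hence, for points \<open>P\<close> of \<open>S\<close> such that
  \<open>x - P\<close> is long and has direction near some \<open>f n\<close>, the distances \<open>N (x - P)\<close> and \<open>N (x' - P)\<close>
  differ by less than \<open>c\<close> and so are equal. Since \<open>S\<close> is well-distributed, such \<open>P\<close> exist for all
  directions near \<open>f n\<close>, so that \<open>N\<close> is constant along \<open>x' - x\<close> near \<open>f n\<close>: the point \<open>f n\<close> is the
  midpoint of a segment of the unit sphere and not extreme.
\<close>

section \<open>Covering radius of a well-distributed set, and thin strips in the plane\<close>

lemma near_of_well_distributed:
  assumes "well_distributed S"
  obtains D where "D > 0" "\<And>p. \<exists>s\<in>S. dist s p \<le> D"
proof -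
  obtain C where C: "C > 0" "\<And>Q. is_square C Q \<Longrightarrow> Q \<inter> S \<noteq> {}"
    using assms unfolding well_distributed_def by blast
  have "\<exists>s\<in>S. dist s p \<le> 2 * C" for p
  proof -
    define u v :: "real^2" where "u = axis 1 1" and "v = axis 2 1"
    let ?Q = "{p + s *\<^sub>R u + t *\<^sub>R v | s t. 0 \<le> s \<and> s \<le> C \<and> 0 \<le> t \<and> t \<le> C}"
    have uv: "norm u = 1" "norm v = 1" "u \<bullet> v = 0"
      by (simp_all add: u_def v_def inner_axis_axis)
    have "is_square C ?Q"
      unfolding is_square_def using uv by blast
    from C(2)[OF this] obtain s t where st: "p + s *\<^sub>R u + t *\<^sub>R v \<in> S"
        "0 \<le> s" "s \<le> C" "0 \<le> t" "t \<le> C" by blast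
    have "dist (p + s *\<^sub>R u + t *\<^sub>R v) p = norm (s *\<^sub>R u + t *\<^sub>R v)"
      by (simp add: dist_norm)
    also have "\<dots> \<le> norm (s *\<^sub>R u) + norm (t *\<^sub>R v)"
      by (rule norm_triangle_ineq)
    also have "\<dots> \<le> 2 * C"
      using st uv by simp
    finally show ?thesis using st(1) by blast
  qed
  with C(1) that[of "2 * C"] show thesis by auto
qed

text \<open>The values of \<open>h\<close> show that \<open>e\<close> is not a multiple of
  \<open>u\<close>, so the two vectors span the plane and \<open>q\<close> is orthogonal to itself.
  Applied to a difference, this says that a functional is determined by its values at
  \<open>e\<close> and \<open>u\<close>.\<close>

lemma eq_0_of_orthogonal_to_pair:
  fixes e u q :: "'a::euclidean_space"
  assumes "DIM('a) = 2" and "h \<bullet> e = 1" "h \<bullet> u = 0" "u \<noteq> 0" and q: "q \<bullet> e = 0" "q \<bullet> u = 0"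
  shows "q = 0"
proof -
  have "e \<notin> span {u}"
    using assms by (auto simp: span_singleton)
  then have "independent {e, u}" "e \<noteq> u"
    using \<open>u \<noteq> 0\<close> by (auto simp: independent_insert span_base)
  then have "UNIV \<subseteq> span {e, u}"
    using assms(1) by (intro card_ge_dim_independent) auto
  then have "q \<in> span {e, u}" by auto
  then have "orthogonal q q"
    by (rule orthogonal_to_span) (use q in \<open>auto simp: orthogonal_def\<close>)
  then show ?thesis by (simp add: orthogonal_def)
qed

text \<open>Infinitely many points of \<open>S\<close> stay near the line spanned by
  \<open>u\<close>, on which \<open>h\<close> vanishes. So \<open>h\<close> is bounded on them, and
  two of its values must be close.\<close>

lemma two_points_in_thin_strip:
  fixes S :: "'a::euclidean_space set"
  assumes D: "D > 0" "\<And>p. \<exists>s\<in>S. dist s p \<le> D"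
    and u: "u \<noteq> 0" "h \<bullet> u = 0" and "c > 0"
  obtains x y where "x \<in> S" "y \<in> S" "x \<noteq> y" "\<bar>h \<bullet> (y - x)\<bar> < c"
proof -
  \<comment> \<open>The spacing \<open>3 * D\<close> exceeds twice the error \<open>D\<close>, so
    points of \<open>S\<close> chosen near different \<open>p k\<close> are different.\<close>
  define p where "p k = (3 * D * real k / norm u) *\<^sub>R u" for k
  have "\<exists>x. x \<in> S \<and> dist x (p k) \<le> D" for k
    using D(2) by blast
  then obtain s where s: "s k \<in> S" "dist (s k) (p k) \<le> D" for k
    by metis
  have "norm (h \<bullet> s k) \<le> norm h * D" for k
  proof -
    have "norm (h \<bullet> s k) = \<bar>h \<bullet> (s k - p k)\<bar>"
      by (simp add: p_def inner_diff_right u)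
    also have "\<dots> \<le> norm h * norm (s k - p k)"
      by (rule Cauchy_Schwarz_ineq2)
    also have "\<dots> \<le> norm h * D"
      using s(2)[of k] by (intro mult_left_mono) (simp_all add: dist_norm)
    finally show ?thesis .
  qed
  then have "bounded (range (\<lambda>k. h \<bullet> s k))"
    by (auto intro!: boundedI)
  then obtain l r where r: "strict_mono r" "((\<lambda>k. h \<bullet> s k) \<circ> r) \<longlonglongrightarrow> l"
    using bounded_imp_convergent_subsequence by metis
  have "Cauchy ((\<lambda>k. h \<bullet> s k) \<circ> r)"
    using r(2) by (rule LIMSEQ_imp_Cauchy)
  then obtain M where M: "\<And>m n. m \<ge> M \<Longrightarrow> n \<ge> M \<Longrightarrow> dist (h \<bullet> s (r m)) (h \<bullet> s (r n)) < c"
    unfolding Cauchy_def using \<open>c > 0\<close> by (metis comp_apply)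
  let ?i = "r M" and ?j = "r (Suc M)"
  have "?i < ?j" using r(1) by (simp add: strict_mono_def)
  have "dist (p ?j) (p ?i) = 3 * D * (real ?j - real ?i)"
  proof -
    have "p ?j - p ?i = (3 * D * (real ?j - real ?i) / norm u) *\<^sub>R u"
      by (simp add: p_def algebra_simps diff_divide_distrib)
    then show ?thesis
      using u D(1) \<open>?i < ?j\<close> by (simp add: dist_norm)
  qed
  also have "\<dots> \<ge> 3 * D * 1"
    using D(1) \<open>?i < ?j\<close> by (intro mult_left_mono) auto
  finally have "dist (p ?j) (p ?i) \<ge> 3 * D" by simp
  then have "s ?i \<noteq> s ?j"
    using s(2)[of ?i] s(2)[of ?j] dist_triangle[of "p ?j" "p ?i" "s ?j"] D(1)
    by (auto simp: dist_commute)
  moreover have "\<bar>h \<bullet> (s ?j - s ?i)\<bar> < c"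
    using M[of "Suc M" M] by (simp add: dist_real_def inner_diff_right)
  ultimately show thesis
    using that s(1) by blast
qed

section \<open>Subgradients of a norm\<close>

text \<open>Definiteness is encoded as boundedness of the unit ball: a nonzero vector with
  \<open>N x = 0\<close> would put a whole line into it.\<close>

locale euclidean_norm =
  fixes N :: "'a::euclidean_space \<Rightarrow> real"
  assumes scale: "N (t *\<^sub>R x) = \<bar>t\<bar> * N x"
    and triangle: "N (x + y) \<le> N x + N y"
    and bounded_ball: "bounded {x. N x \<le> 1}"
begin

text \<open>For a norm this is equivalent to the usual condition that \<open>N z\<close> is at least
  \<open>N y + g \<bullet> (z - y)\<close> for all \<open>z\<close>, as \<open>z = 0\<close> and
  \<open>z = 2 *\<^sub>R y\<close> show.\<close>

definition subgradient :: "'a \<Rightarrow> 'a \<Rightarrow> bool" where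
  "subgradient y g \<longleftrightarrow> g \<bullet> y = N y \<and> (\<forall>z. g \<bullet> z \<le> N z)"

lemma N_0 [simp]: "N 0 = 0"
  using scale[of 0 0] by simp

lemma N_minus [simp]: "N (- x) = N x"
  using scale[of "-1" x] by simp

lemma N_nonneg: "0 \<le> N x"
  using triangle[of x "- x"] by simp

lemma N_pos:
  assumes "x \<noteq> 0"
  shows "0 < N x"
proof (rule ccontr)
  assume "\<not> 0 < N x"
  then have "N x = 0" using N_nonneg[of x] by simp
  obtain B where B: "\<And>y. N y \<le> 1 \<Longrightarrow> norm y \<le> B"
    using bounded_ball by (auto simp: bounded_iff)
  have "N (((\<bar>B\<bar> + 1) / norm x) *\<^sub>R x) \<le> 1"
    using \<open>N x = 0\<close> by (simp add: scale)
  from B[OF this] show False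
    using assms by simp
qed

lemma convex_N: "convex_on UNIV N"
  by (rule convex_onI) (auto intro!: order_trans[OF triangle] simp: scale)

lemma continuous_N: "continuous_on UNIV N"
  by (rule convex_on_continuous) (auto simp: convex_N)

lemma tendsto_N [tendsto_intros]:
  assumes "(f \<longlongrightarrow> l) F"
  shows "((\<lambda>n. N (f n)) \<longlongrightarrow> N l) F"
  using continuous_on_tendsto_compose[OF continuous_N assms] by simp

lemma convex_ball: "convex {x. N x \<le> 1}"
proof (rule convexI)
  fix x y :: 'a and u v :: real
  assume "x \<in> {x. N x \<le> 1}" "y \<in> {x. N x \<le> 1}" and uv: "0 \<le> u" "0 \<le> v" "u + v = 1"
  then have "N (u *\<^sub>R x + v *\<^sub>R y) \<le> u * N x + v * N y"
    using triangle[of "u *\<^sub>R x" "v *\<^sub>R y"] by (simp add: scale)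
  also have "\<dots> \<le> u * 1 + v * 1"
    using uv \<open>x \<in> _\<close> \<open>y \<in> _\<close> by (intro add_mono mult_left_mono) auto
  finally show "u *\<^sub>R x + v *\<^sub>R y \<in> {x. N x \<le> 1}"
    using uv by simp
qed

lemma compact_ball: "compact {x. N x \<le> 1}"
  unfolding compact_eq_bounded_closed
  using bounded_ball continuous_N by (auto intro!: closed_Collect_le)

lemma N_le_norm:
  obtains M where "\<And>x. N x \<le> M * norm x"
proof -
  have "compact (N ` sphere 0 1)"
    by (intro compact_continuous_image continuous_on_subset[OF continuous_N]) auto
  then obtain M where M: "\<And>y. norm y = 1 \<Longrightarrow> N y \<le> M"
    unfolding compact_eq_bounded_closed bounded_iff by (force simp: abs_le_iff)
  have "N x \<le> M * norm x" for x
  proof (cases "x = 0")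
    case False
    then show ?thesis
      using M[of "(1 / norm x) *\<^sub>R x"] by (simp add: scale field_simps)
  qed auto
  then show thesis by (rule that)
qed

text \<open>A hyperplane separating \<open>y\<close> from the open ball of radius \<open>N y\<close>
  supports the ball at \<open>y\<close>; its normal is rescaled to take the value \<open>N y\<close>
  at \<open>y\<close>.\<close>

lemma subgradient_exists:
  assumes "y \<noteq> 0"
  obtains g where "subgradient y g"
proof -
  have Ny: "0 < N y" using N_pos[OF assms] .
  have conv: "convex {x. N x < N y}"
  proof (rule convexI)
    fix a b :: 'a and u v :: real
    assume ab: "a \<in> {x. N x < N y}" "b \<in> {x. N x < N y}" and uv: "0 \<le> u" "0 \<le> v" "u + v = 1"
    have "N (u *\<^sub>R a + v *\<^sub>R b) \<le> u * N a + v * N b"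
      using triangle[of "u *\<^sub>R a" "v *\<^sub>R b"] uv by (simp add: scale)
    also have "\<dots> < N y"
      using ab uv by (intro convex_bound_lt) auto
    finally show "u *\<^sub>R a + v *\<^sub>R b \<in> {x. N x < N y}" by simp
  qed
  have "{x. N x < N y} \<noteq> {}"
    using Ny by (auto intro!: exI[of _ 0])
  then obtain a b where a: "a \<noteq> 0" "\<forall>x\<in>{x. N x < N y}. a \<bullet> x \<le> b" "\<forall>x\<in>{y}. a \<bullet> x \<ge> b"
    using separating_hyperplane_sets[OF conv convex_singleton[of y]] by auto
  \<comment> \<open>The separation concerns the open ball; shrinking by \<open>s < 1\<close> and
    letting \<open>s\<close> tend to 1 extends it to the closed ball.\<close>
  have le: "a \<bullet> x \<le> a \<bullet> y" if "N x \<le> N y" for x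
  proof (rule field_le_mult_one_interval)
    fix s :: real assume s: "0 < s" "s < 1"
    have "s * N x \<le> s * N y" using that s by simp
    also have "\<dots> < N y" using s Ny by simp
    finally have "N (s *\<^sub>R x) < N y" using s by (simp add: scale)
    then show "s * (a \<bullet> x) \<le> a \<bullet> y" using a by force
  qed
  have Na: "0 < N a" using N_pos[OF a(1)] .
  have "0 < a \<bullet> ((N y / N a) *\<^sub>R a)"
    using a(1) Ny Na by simp
  also have "\<dots> \<le> a \<bullet> y"
    using Ny Na by (intro le) (simp add: scale)
  finally have pos: "0 < a \<bullet> y" .
  have "(N y / (a \<bullet> y)) *\<^sub>R a \<bullet> z \<le> N z" for z
  proof (cases "z = 0")
    case False
    then have Nz: "0 < N z" by (rule N_pos)
    have "a \<bullet> ((N y / N z) *\<^sub>R z) \<le> a \<bullet> y"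
      using Ny Nz by (intro le) (simp add: scale)
    then show ?thesis
      using pos Nz by (simp add: field_simps)
  qed auto
  with pos have "subgradient y ((N y / (a \<bullet> y)) *\<^sub>R a)"
    by (simp add: subgradient_def)
  then show thesis by (rule that)
qed

lemma subgradient_scale:
  assumes "subgradient y g" "t > 0"
  shows "subgradient (t *\<^sub>R y) g"
  using assms by (simp add: subgradient_def scale)

text \<open>Testing \<open>g\<close> against itself bounds the square of \<open>norm g\<close> by
  \<open>N g\<close>, hence by a multiple of \<open>norm g\<close>.\<close>

lemma subgradient_bounded:
  obtains M where "\<And>y g. subgradient y g \<Longrightarrow> norm g \<le> M"
proof -
  obtain M where M: "\<And>x. N x \<le> M * norm x" by (rule N_le_norm) blast
  have "norm g \<le> \<bar>M\<bar>" if "subgradient y g" for y g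
  proof (cases "g = 0")
    case False
    have "norm g * norm g = g \<bullet> g" by (simp add: dot_square_norm power2_eq_square)
    also have "\<dots> \<le> N g" using that by (simp add: subgradient_def)
    also have "\<dots> \<le> M * norm g" by (rule M)
    finally show ?thesis using False by simp
  qed auto
  then show thesis by (rule that)
qed

lemma subgradient_closed:
  assumes "y \<longlonglongrightarrow> y'" "g \<longlonglongrightarrow> g'" and sub: "\<And>n. subgradient (y n) (g n)"
  shows "subgradient y' g'"
  unfolding subgradient_def
proof (intro conjI allI)
  have "(\<lambda>n. g n \<bullet> y n) \<longlonglongrightarrow> g' \<bullet> y'"
    by (intro tendsto_intros assms)
  moreover have "(\<lambda>n. g n \<bullet> y n) \<longlonglongrightarrow> N y'"
    using sub by (simp add: subgradient_def tendsto_N assms(1))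
  ultimately show "g' \<bullet> y' = N y'" by (rule LIMSEQ_unique)
  fix z
  have "(\<lambda>n. g n \<bullet> z) \<longlonglongrightarrow> g' \<bullet> z"
    by (intro tendsto_intros assms)
  then show "g' \<bullet> z \<le> N z"
    by (rule LIMSEQ_le_const2) (use sub in \<open>auto simp: subgradient_def\<close>)
qed

text \<open>
  In the plane the two conclusions determine \<open>g'\<close>: on each side of a point of the unit circle
  there is only one limit of subgradients.
\<close>

lemma subgradient_one_sided_limit:
  assumes f: "f \<longlonglongrightarrow> e" "\<And>n. N (f n) = 1" "N e = 1"
    and d: "\<And>n. d n > 0" "(\<lambda>n. (1 / d n) *\<^sub>R (f n - e)) \<longlonglongrightarrow> u"
    and g: "\<And>n. subgradient (f n) (g n)" "g \<longlonglongrightarrow> g'"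
  shows "g' \<bullet> e = 1" "g' \<bullet> u = 0"
proof -
  have g': "subgradient e g'"
    using f(1) g(2,1) by (rule subgradient_closed)
  then show "g' \<bullet> e = 1" using f by (simp add: subgradient_def)
  \<comment> \<open>Since \<open>f n\<close> and \<open>e\<close> have the same norm, the support
    inequality at \<open>f n\<close> makes \<open>g n\<close> nonnegative on the secant direction,
    and the one at \<open>e\<close> makes \<open>g'\<close> nonpositive on it. Both values tend to
    \<open>g' \<bullet> u\<close>.\<close>
  have "(\<lambda>n. g n \<bullet> ((1 / d n) *\<^sub>R (f n - e))) \<longlonglongrightarrow> g' \<bullet> u"
    by (intro tendsto_intros d g)
  moreover have "g n \<bullet> ((1 / d n) *\<^sub>R (f n - e)) \<ge> 0" for n
  proof -
    have "g n \<bullet> e \<le> g n \<bullet> f n"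
      using g(1)[of n] f(2)[of n] f(3) by (metis subgradient_def)
    then show ?thesis using d(1)[of n] by (simp add: inner_diff_right)
  qed
  ultimately have "0 \<le> g' \<bullet> u"
    by (intro LIMSEQ_le_const) auto
  have "(\<lambda>n. g' \<bullet> ((1 / d n) *\<^sub>R (f n - e))) \<longlonglongrightarrow> g' \<bullet> u"
    by (intro tendsto_intros d)
  moreover have "g' \<bullet> ((1 / d n) *\<^sub>R (f n - e)) \<le> 0" for n
  proof -
    have "g' \<bullet> f n \<le> g' \<bullet> e"
      using g' f(2)[of n] f(3) by (metis subgradient_def)
    then show ?thesis using d(1)[of n] by (simp add: inner_diff_right divide_le_0_iff)
  qed
  ultimately have "g' \<bullet> u \<le> 0"
    by (intro LIMSEQ_le_const2) auto
  with \<open>0 \<le> g' \<bullet> u\<close> show "g' \<bullet> u = 0" by simp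
qed

text \<open>This is convexity of \<open>N\<close> along a line: the triangle inequality is applied
  to the endpoint of the chord that lies between the other endpoint and
  \<open>y + s *\<^sub>R w\<close>.\<close>

lemma N_le_outside_chord:
  assumes eq: "N (y + w) = N y" and s: "s \<le> 0 \<or> s \<ge> 1"
  shows "N y \<le> N (y + s *\<^sub>R w)"
proof (cases "s \<ge> 1")
  case True
  have "s *\<^sub>R (y + w) = (s - 1) *\<^sub>R y + (y + s *\<^sub>R w)"
    by (simp add: algebra_simps)
  then have "s * N (y + w) \<le> (s - 1) * N y + N (y + s *\<^sub>R w)"
    using triangle[of "(s - 1) *\<^sub>R y" "y + s *\<^sub>R w"] True scale[of s "y + w"]
    by (simp add: scale)
  then show ?thesis using eq by (simp add: algebra_simps)
next
  case False
  then have "s \<le> 0" using s by simp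
  have "(1 - s) *\<^sub>R y = (- s) *\<^sub>R (y + w) + (y + s *\<^sub>R w)"
    by (simp add: algebra_simps)
  then have "(1 - s) * N y \<le> (- s) * N (y + w) + N (y + s *\<^sub>R w)"
    using triangle[of "(- s) *\<^sub>R (y + w)" "y + s *\<^sub>R w"] \<open>s \<le> 0\<close> scale[of "1 - s" y]
      scale[of "- s" "y + w"]
    by simp
  then show ?thesis using eq by (simp add: algebra_simps)
qed

text \<open>The support inequality at \<open>y\<close> bounds the difference from below by
  \<open>g \<bullet> w\<close>, and the one at \<open>y + w\<close> bounds it from above by
  \<open>k \<bullet> w\<close>.\<close>

lemma abs_N_diff_less:
  assumes "y \<noteq> 0" "y + w \<noteq> 0"
    and "\<And>g. subgradient y g \<Longrightarrow> \<bar>g \<bullet> w\<bar> < c" "\<And>g. subgradient (y + w) g \<Longrightarrow> \<bar>g \<bullet> w\<bar> < c"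
  shows "\<bar>N (y + w) - N y\<bar> < c"
proof -
  obtain g where g: "subgradient y g" using subgradient_exists assms(1) .
  obtain k where k: "subgradient (y + w) k" using subgradient_exists assms(2) .
  have "N (y + w) - N y \<ge> g \<bullet> w"
  proof -
    have "g \<bullet> y = N y" "g \<bullet> (y + w) \<le> N (y + w)"
      using g unfolding subgradient_def by blast+
    then show ?thesis by (simp add: inner_add_right)
  qed
  moreover have "N (y + w) - N y \<le> k \<bullet> w"
  proof -
    have "k \<bullet> y \<le> N y" "k \<bullet> (y + w) = N (y + w)"
      using k unfolding subgradient_def by blast+
    then show ?thesis by (simp add: inner_add_right)
  qed
  ultimately show ?thesis
    using assms(3)[OF g] assms(4)[OF k] by linarith
qed

section \<open>Extreme points of the unit ball\<close>

text \<open>Adding \<open>w = x' - x\<close> does not change the norm of long vectors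
  \<open>x - P\<close> with direction near \<open>a\<close>. Scaled down, such a pair is a tiny
  chord in direction \<open>w\<close> near a given \<open>b\<close>, so by convexity and a limit
  \<open>N\<close> is minimal at \<open>b\<close> along the line through \<open>b\<close> in
  direction \<open>w\<close>. This holds for every \<open>b\<close> near \<open>a\<close>.\<close>

lemma not_extreme_point:
  assumes D: "\<And>p. \<exists>s\<in>S. dist s p \<le> D"
    and sep: "\<And>x x' y. x \<in> S \<Longrightarrow> x' \<in> S \<Longrightarrow> y \<in> S \<Longrightarrow> \<bar>N (x' - y) - N (x - y)\<bar> < c
      \<Longrightarrow> N (x' - y) = N (x - y)"
    and x: "x \<in> S" "x' \<in> S" "x \<noteq> x'"
    and "\<delta> > 0"
    and good: "\<And>y g. N y = 1 \<Longrightarrow> dist y a < \<delta> \<Longrightarrow> subgradient y g \<Longrightarrow> \<bar>g \<bullet> (x' - x)\<bar> < c"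
    and a: "N a = 1"
  shows "\<not> a extreme_point_of {x. N x \<le> 1}"
proof
  assume ext: "a extreme_point_of {x. N x \<le> 1}"
  define w where "w = x' - x"
  \<comment> \<open>\<open>U\<close> is the open cone of vectors whose normalisation is within
    \<open>\<delta>\<close> of \<open>a\<close>. Subgradients are unchanged by positive scaling of
    the point, so the bound in \<open>good\<close> holds on all of \<open>U\<close>.\<close>
  define U where "U = {z \<in> - {0}. (1 / N z) *\<^sub>R z \<in> ball a \<delta>}"
  have cont: "continuous_on (- {0}) (\<lambda>z. (1 / N z) *\<^sub>R z)"
    using N_pos by (intro continuous_intros continuous_on_subset[OF continuous_N]) force+
  have "open U"
    unfolding U_def using continuous_open_preimage[OF cont open_Compl[OF closed_singleton] open_ball]
    by (simp add: vimage_def Int_def)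
  have "a \<in> U"
    using a \<open>\<delta> > 0\<close> by (auto simp: U_def)
  have cone: "r *\<^sub>R z \<in> U" if "z \<in> U" "r > 0" for r z
    using that by (auto simp: U_def scale)
  have U_good: "z \<noteq> 0 \<and> (\<forall>g. subgradient z g \<longrightarrow> \<bar>g \<bullet> w\<bar> < c)" if "z \<in> U" for z
  proof -
    have z: "z \<noteq> 0" "dist ((1 / N z) *\<^sub>R z) a < \<delta>"
      using that by (auto simp: U_def dist_commute)
    moreover have "N ((1 / N z) *\<^sub>R z) = 1" "1 / N z > 0"
      using N_pos[OF z(1)] by (simp_all add: scale)
    ultimately show ?thesis
      unfolding w_def using good subgradient_scale by blast
  qed
  have mono: "N b \<le> N (b + t *\<^sub>R w)" if "b \<in> U" for b t
  proof -
    have "\<exists>p. p \<in> S \<and> dist p (x - real n *\<^sub>R b) \<le> D" for n :: nat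
      using D by blast
    then obtain P where P: "P n \<in> S" "dist (P n) (x - real n *\<^sub>R b) \<le> D" for n :: nat
      by metis
    define y where "y n = x - P n" for n
    have lim0: "(\<lambda>n. (1 / real n) *\<^sub>R (y n - real n *\<^sub>R b)) \<longlonglongrightarrow> 0"
    proof (rule Lim_null_comparison)
      \<comment> \<open>At \<open>n = 0\<close> both sides are 0, because
        \<open>1 / 0 = 0\<close>.\<close>
      show "\<forall>\<^sub>F n in sequentially. norm ((1 / real n) *\<^sub>R (y n - real n *\<^sub>R b)) \<le> D * (1 / real n)"
      proof (rule always_eventually, rule allI)
        fix n
        have "norm (y n - real n *\<^sub>R b) \<le> D"
          using P(2)[of n] by (simp add: y_def dist_norm norm_minus_commute algebra_simps)
        then show "norm ((1 / real n) *\<^sub>R (y n - real n *\<^sub>R b)) \<le> D * (1 / real n)"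
          by (simp add: divide_right_mono)
      qed
      show "(\<lambda>n. D * (1 / real n)) \<longlonglongrightarrow> 0"
        using tendsto_mult_right_zero[OF lim_1_over_n] by blast
    qed
    have "(\<lambda>n. (1 / real n) *\<^sub>R (y n - real n *\<^sub>R b) + b) \<longlonglongrightarrow> 0 + b"
      by (intro tendsto_intros lim0)
    moreover have "\<forall>\<^sub>F n in sequentially.
        (1 / real n) *\<^sub>R (y n - real n *\<^sub>R b) + b = (1 / real n) *\<^sub>R y n"
      using eventually_gt_at_top[of 0] by eventually_elim (simp add: scaleR_diff_right)
    ultimately have "(\<lambda>n. (1 / real n) *\<^sub>R y n) \<longlonglongrightarrow> 0 + b"
      by (rule Lim_transform_eventually)
    then have lim: "(\<lambda>n. (1 / real n) *\<^sub>R y n) \<longlonglongrightarrow> b" by simp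
    have "(\<lambda>n. (1 / real n) *\<^sub>R y n + (1 / real n) *\<^sub>R w) \<longlonglongrightarrow> b + 0 *\<^sub>R w"
      by (intro tendsto_intros lim lim_1_over_n)
    then have lim': "(\<lambda>n. (1 / real n) *\<^sub>R (y n + w)) \<longlonglongrightarrow> b"
      by (simp add: scaleR_add_right)
    have "\<forall>\<^sub>F n in sequentially. (1 / real n) *\<^sub>R y n \<in> U"
      using topological_tendstoD[OF lim \<open>open U\<close> that] .
    moreover have "\<forall>\<^sub>F n in sequentially. (1 / real n) *\<^sub>R (y n + w) \<in> U"
      using topological_tendstoD[OF lim' \<open>open U\<close> that] .
    \<comment> \<open>After scaling by \<open>1 / real n\<close>, the chord from \<open>y n\<close>
      to \<open>y n + w\<close> covers the parameters from 0 to \<open>1 / real n\<close>, so a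
      fixed \<open>t\<close> is eventually not inside it.\<close>
    moreover have "\<forall>\<^sub>F n in sequentially. t \<le> 0 \<or> real n * t \<ge> 1"
    proof (cases "t \<le> 0")
      case False
      have "\<forall>\<^sub>F n in sequentially. real n \<ge> 1 / t"
        using filterlim_real_sequentially by (simp add: filterlim_at_top)
      then show ?thesis
        by eventually_elim (use False in \<open>simp add: field_simps\<close>)
    qed auto
    ultimately have "\<forall>\<^sub>F n in sequentially.
        N ((1 / real n) *\<^sub>R y n) \<le> N ((1 / real n) *\<^sub>R y n + t *\<^sub>R w)"
      using eventually_gt_at_top[of 0]
    proof eventually_elim
      case (elim n)
      have "y n \<in> U" "y n + w \<in> U"
        using cone[OF elim(1), of "real n"] cone[OF elim(2), of "real n"] elim(4) by auto
      then have "\<bar>N (y n + w) - N (y n)\<bar> < c"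
        using U_good by (intro abs_N_diff_less) blast+
      moreover have "y n + w = x' - P n" by (simp add: y_def w_def)
      ultimately have "N (y n + w) = N (y n)"
        using sep[OF x(1,2) P(1)[of n]] by (metis y_def)
      then have "N (y n) \<le> N (y n + (real n * t) *\<^sub>R w)"
        by (rule N_le_outside_chord) (use elim in \<open>auto simp: mult_nonneg_nonpos\<close>)
      moreover have "y n + (real n * t) *\<^sub>R w = real n *\<^sub>R ((1 / real n) *\<^sub>R y n + t *\<^sub>R w)"
        using elim(4) by (simp add: scaleR_add_right)
      ultimately have "N (y n) \<le> real n * N ((1 / real n) *\<^sub>R y n + t *\<^sub>R w)"
        by (simp only: scale abs_of_nat)
      moreover have "N ((1 / real n) *\<^sub>R y n) = N (y n) / real n"
        by (simp add: scale)
      ultimately show ?case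
        using elim(4) by (simp add: pos_divide_le_eq mult.commute)
    qed
    then show ?thesis
      by (rule tendsto_le[OF sequentially_bot, rotated 2]) (intro tendsto_intros lim)+
  qed
  have "((\<lambda>t. a + t *\<^sub>R w) \<longlongrightarrow> a + 0 *\<^sub>R w) (at_right 0)" "((\<lambda>t. a - t *\<^sub>R w) \<longlongrightarrow> a - 0 *\<^sub>R w) (at_right 0)"
    by (intro tendsto_intros)+
  then have "\<forall>\<^sub>F t in at_right 0. a + t *\<^sub>R w \<in> U" "\<forall>\<^sub>F t in at_right 0. a - t *\<^sub>R w \<in> U"
    using \<open>open U\<close> \<open>a \<in> U\<close> by (auto dest: topological_tendstoD)
  moreover have "\<forall>\<^sub>F t::real in at_right 0. t > 0"
    by (simp add: eventually_at_right_less)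
  ultimately have "\<forall>\<^sub>F t in at_right 0. a + t *\<^sub>R w \<in> U \<and> a - t *\<^sub>R w \<in> U \<and> t > 0"
    by eventually_elim auto
  then obtain t where t: "a + t *\<^sub>R w \<in> U" "a - t *\<^sub>R w \<in> U" "t > 0"
    using eventually_happens'[OF trivial_limit_at_right_real] by blast
  \<comment> \<open>Minimality is used at the two neighbours of \<open>a\<close>, moving back to
    \<open>a\<close>, so neither has larger norm than \<open>a\<close>.\<close>
  have "N (a + t *\<^sub>R w) \<le> 1" "N (a - t *\<^sub>R w) \<le> 1"
    using mono[OF t(1), of "- t"] mono[OF t(2), of t] a by simp_all
  moreover have "a \<in> open_segment (a - t *\<^sub>R w) (a + t *\<^sub>R w)"
    unfolding in_segment using t(3) x(3)
    by (auto intro!: exI[of _ "1/2"] simp: w_def algebra_simps simp flip: scaleR_add_left)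
  ultimately show False
    using ext by (auto simp: extreme_point_of_def)
qed

lemma extreme_point_norm_1:
  assumes "a extreme_point_of {x. N x \<le> 1}"
  shows "N a = 1"
proof (rule ccontr)
  assume "N a \<noteq> 1"
  then have "a \<in> {x. N x < 1}"
    using assms by (auto simp: extreme_point_of_def)
  moreover have "open {x. N x < 1}"
    using continuous_N by (intro open_Collect_less) auto
  ultimately have "a \<in> interior {x. N x \<le> 1}"
    by (intro interiorI[of "{x. N x < 1}"]) auto
  then show False
    using extreme_point_not_in_interior[OF assms] by simp
qed

text \<open>If the extreme points \<open>f (r n)\<close> accumulate at \<open>e\<close>, then by
  \<open>not_extreme_point\<close> there are points \<open>y n\<close> arbitrarily close to them
  with subgradients \<open>k n\<close> that are large on \<open>x' - x\<close> in absolute value.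
  Taken close enough, the \<open>y n\<close> approach \<open>e\<close> in the same direction
  \<open>u\<close>, which forces a subsequence of the \<open>k n\<close> to converge to
  \<open>h\<close>, and \<open>h\<close> is small there.\<close>

lemma finite_extreme_points:
  assumes dim: "DIM('a) = 2"
    and D: "D > 0" "\<And>p. \<exists>s\<in>S. dist s p \<le> D"
    and c: "c > 0"
    and sep: "\<And>x x' y. x \<in> S \<Longrightarrow> x' \<in> S \<Longrightarrow> y \<in> S \<Longrightarrow> \<bar>N (x' - y) - N (x - y)\<bar> < c
      \<Longrightarrow> N (x' - y) = N (x - y)"
  shows "finite {a. a extreme_point_of {x. N x \<le> 1}}" (is "finite ?E")
proof (rule ccontr)
  assume "infinite ?E"
  moreover have "?E \<subseteq> {x. N x \<le> 1}"
    by (auto simp: extreme_point_of_def)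
  ultimately obtain e where "e islimpt ?E"
    using compact_ball unfolding compact_eq_Bolzano_Weierstrass by metis
  then obtain f where f: "\<And>n. f n \<in> ?E - {e}" "f \<longlonglongrightarrow> e"
    unfolding islimpt_sequential by blast
  have Nf: "N (f n) = 1" for n
    using f(1) by (intro extreme_point_norm_1) auto
  have Ne: "N e = 1"
    using tendsto_N[OF f(2)] by (simp add: Nf LIMSEQ_const_iff)
  have "\<exists>g. subgradient (f n) g" for n
  proof -
    have "f n \<noteq> 0" using Nf[of n] by auto
    then show ?thesis using subgradient_exists by blast
  qed
  then obtain g where g: "\<And>n. subgradient (f n) (g n)"
    by metis
  obtain M where M: "\<And>y g. subgradient y g \<Longrightarrow> norm g \<le> M"
    by (rule subgradient_bounded) blast
  define d where "d n = dist (f n) e" for n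
  have d: "d n > 0" for n using f(1)[of n] by (simp add: d_def)
  have d0: "d \<longlonglongrightarrow> 0" unfolding d_def using f(2) tendsto_dist_iff by blast
  \<comment> \<open>Direction and subgradient form a pair so that one subsequence makes both
    converge.\<close>
  have "norm ((1 / d n) *\<^sub>R (f n - e), g n) \<le> 1 + M" for n
  proof -
    have "norm ((1 / d n) *\<^sub>R (f n - e)) = 1"
      using d[of n] by (simp add: d_def dist_norm)
    then show ?thesis
      using norm_Pair_le[of "(1 / d n) *\<^sub>R (f n - e)" "g n"] M[OF g[of n]] by linarith
  qed
  then have "bounded (range (\<lambda>n. ((1 / d n) *\<^sub>R (f n - e), g n)))"
    by (auto intro!: boundedI)
  from bounded_imp_convergent_subsequence[OF this] obtain l r
    where r: "strict_mono r" and l: "((\<lambda>n. ((1 / d n) *\<^sub>R (f n - e), g n)) \<circ> r) \<longlonglongrightarrow> l"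
    by blast
  define u h where "u = fst l" and "h = snd l"
  have lim_u: "(\<lambda>n. (1 / d (r n)) *\<^sub>R (f (r n) - e)) \<longlonglongrightarrow> u"
    and lim_h: "(\<lambda>n. g (r n)) \<longlonglongrightarrow> h"
    using tendsto_fst[OF l] tendsto_snd[OF l] by (simp_all add: u_def h_def comp_def)
  have fr: "(\<lambda>n. f (r n)) \<longlonglongrightarrow> e" "(\<lambda>n. d (r n)) \<longlonglongrightarrow> 0"
    using LIMSEQ_subseq_LIMSEQ[OF f(2) r] LIMSEQ_subseq_LIMSEQ[OF d0 r] by (simp_all add: comp_def)
  have h: "h \<bullet> e = 1" "h \<bullet> u = 0"
    using subgradient_one_sided_limit[OF fr(1) Nf Ne d lim_u g lim_h] by auto
  have "(\<lambda>n. norm ((1 / d (r n)) *\<^sub>R (f (r n) - e))) \<longlonglongrightarrow> norm u"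
    by (intro tendsto_intros lim_u)
  moreover have "norm ((1 / d (r n)) *\<^sub>R (f (r n) - e)) = 1" for n
    using d[of "r n"] by (simp add: d_def dist_norm)
  ultimately have "norm u = 1" by (simp only: LIMSEQ_const_iff)
  then have "u \<noteq> 0" by auto
  obtain x x' where x: "x \<in> S" "x' \<in> S" "x \<noteq> x'" "\<bar>h \<bullet> (x' - x)\<bar> < c"
    using two_points_in_thin_strip[OF D \<open>u \<noteq> 0\<close> h(2) c] by blast
  \<comment> \<open>The radius is small compared with the distance \<open>d (r n)\<close> to
    \<open>e\<close>, so replacing \<open>f (r n)\<close> by \<open>y n\<close> keeps the limiting
    direction \<open>u\<close>.\<close>
  have "\<exists>y k. N y = 1 \<and> dist y (f (r n)) < d (r n) / Suc n \<and> subgradient y k \<and> \<bar>k \<bullet> (x' - x)\<bar> \<ge> c"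
    for n
  proof (rule ccontr)
    assume *: "\<not> ?thesis"
    have "\<not> f (r n) extreme_point_of {x. N x \<le> 1}"
      by (rule not_extreme_point[where \<delta> = "d (r n) / Suc n", OF D(2) sep x(1-3) _ _ Nf])
        (use * d[of "r n"] in \<open>auto simp: not_le\<close>)
    then show False using f(1) by blast
  qed
  then obtain y k where y: "\<And>n. N (y n) = 1" "\<And>n. dist (y n) (f (r n)) < d (r n) / Suc n"
    and k: "\<And>n. subgradient (y n) (k n)" "\<And>n. \<bar>k n \<bullet> (x' - x)\<bar> \<ge> c"
    by metis
  have "bounded (range k)"
    using M k(1) by (auto intro!: boundedI)
  from bounded_imp_convergent_subsequence[OF this] obtain k' q
    where q: "strict_mono q" "(k \<circ> q) \<longlonglongrightarrow> k'" by blast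
  have lim_diff: "(\<lambda>n. (1 / d (r n)) *\<^sub>R (y n - f (r n))) \<longlonglongrightarrow> 0"
  proof (rule Lim_null_comparison)
    show "\<forall>\<^sub>F n in sequentially. norm ((1 / d (r n)) *\<^sub>R (y n - f (r n))) \<le> 1 / Suc n"
    proof (rule always_eventually, rule allI)
      fix n
      show "norm ((1 / d (r n)) *\<^sub>R (y n - f (r n))) \<le> 1 / Suc n"
        using y(2)[of n] d[of "r n"] by (simp add: dist_norm divide_simps mult.commute del: of_nat_Suc)
    qed
    show "(\<lambda>n. 1 / real (Suc n)) \<longlonglongrightarrow> 0"
      using LIMSEQ_inverse_real_of_nat by (simp add: inverse_eq_divide)
  qed
  have "(\<lambda>n. (1 / d (r n)) *\<^sub>R (y n - f (r n)) + (1 / d (r n)) *\<^sub>R (f (r n) - e)) \<longlonglongrightarrow> 0 + u"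
    by (intro tendsto_add lim_diff lim_u)
  then have lim_yu: "(\<lambda>n. (1 / d (r n)) *\<^sub>R (y n - e)) \<longlonglongrightarrow> u"
    by (simp flip: scaleR_add_right)
  have "(\<lambda>n. d (r n) *\<^sub>R ((1 / d (r n)) *\<^sub>R (y n - e)) + e) \<longlonglongrightarrow> 0 *\<^sub>R u + e"
    by (intro tendsto_intros fr lim_yu)
  moreover have "d (r n) *\<^sub>R ((1 / d (r n)) *\<^sub>R (y n - e)) + e = y n" for n
    using d[of "r n"] by simp
  ultimately have "y \<longlonglongrightarrow> e" by simp
  then have yq: "(\<lambda>n. y (q n)) \<longlonglongrightarrow> e"
    "(\<lambda>n. (1 / d (r (q n))) *\<^sub>R (y (q n) - e)) \<longlonglongrightarrow> u"
    using LIMSEQ_subseq_LIMSEQ[OF \<open>y \<longlonglongrightarrow> e\<close> q(1)] LIMSEQ_subseq_LIMSEQ[OF lim_yu q(1)]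
    by (simp_all add: comp_def)
  have lim_k: "(\<lambda>n. k (q n)) \<longlonglongrightarrow> k'" using q(2) by (simp add: comp_def)
  have k': "k' \<bullet> e = 1" "k' \<bullet> u = 0"
    using subgradient_one_sided_limit[OF yq(1) y(1) Ne d yq(2) k(1) lim_k] by auto
  have "k' - h = 0"
    by (rule eq_0_of_orthogonal_to_pair[OF dim h \<open>u \<noteq> 0\<close>]) (simp_all add: inner_diff_left h k')
  then have "k' = h" by simp
  have "(\<lambda>n. \<bar>k (q n) \<bullet> (x' - x)\<bar>) \<longlonglongrightarrow> \<bar>k' \<bullet> (x' - x)\<bar>"
    by (intro tendsto_intros lim_k)
  then have "c \<le> \<bar>k' \<bullet> (x' - x)\<bar>"
    by (rule LIMSEQ_le_const) (use k(2) in auto)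
  with x(4) \<open>k' = h\<close> show False by simp
qed

end


section \<open>The gauge of a symmetric convex body\<close>

text \<open>\<open>K_dist\<close> is the infimum of this set in the extended reals,
  \<open>minkowski_gauge\<close> its infimum in the reals.\<close>

definition gauge_set :: "'a::euclidean_space set \<Rightarrow> 'a \<Rightarrow> real set" where
  "gauge_set K z = {t. 0 \<le> t \<and> z \<in> (\<lambda>x. t *\<^sub>R x) ` K}"

lemma mem_gauge_setI: "0 \<le> t \<Longrightarrow> k \<in> K \<Longrightarrow> z = t *\<^sub>R k \<Longrightarrow> t \<in> gauge_set K z"
  by (auto simp: gauge_set_def)

definition minkowski_gauge :: "'a::euclidean_space set \<Rightarrow> 'a \<Rightarrow> real" where
  "minkowski_gauge K z = Inf (gauge_set K z)"

locale symmetric_convex_body =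
  fixes K :: "'a::euclidean_space set"
  assumes bounded: "bounded K" and convex: "convex K"
    and symmetric: "x \<in> K \<Longrightarrow> - x \<in> K"
    and interior: "interior K \<noteq> {}"
begin

text \<open>The origin is the midpoint of an interior point and its negative.\<close>

lemma zero_in_interior: "0 \<in> interior K"
proof -
  obtain x where x: "x \<in> interior K" using interior by blast
  have "uminus ` K = K"
    using symmetric by (force simp: image_iff)
  then have "- x \<in> interior K"
    using x interior_negations[of K] by (metis imageI)
  then have "(1/2) *\<^sub>R x + (1/2) *\<^sub>R (- x) \<in> interior K"
    using x convex_interior[OF convex] by (intro convexD) auto
  then show ?thesis by simp
qed

lemma scale_mem:
  assumes "x \<in> K" "\<bar>r\<bar> \<le> 1"
  shows "r *\<^sub>R x \<in> K"
proof -
  have "((1 + r) / 2) *\<^sub>R x + ((1 - r) / 2) *\<^sub>R (- x) \<in> K"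
    using assms symmetric by (intro convexD[OF convex]) (auto simp: field_simps)
  also have "((1 + r) / 2) *\<^sub>R x + ((1 - r) / 2) *\<^sub>R (- x) = r *\<^sub>R x"
    by (simp flip: scaleR_diff_left add: field_simps)
  finally show ?thesis .
qed

lemma gauge_set_upward:
  assumes "t \<in> gauge_set K z" "t \<le> s"
  shows "s \<in> gauge_set K z"
proof (cases "s = 0")
  case True
  then show ?thesis using assms by (auto simp: gauge_set_def)
next
  case False
  obtain k where k: "0 \<le> t" "k \<in> K" "z = t *\<^sub>R k"
    using assms by (auto simp: gauge_set_def)
  then have "z = s *\<^sub>R ((t / s) *\<^sub>R k)" using False by simp
  moreover have "(t / s) *\<^sub>R k \<in> K"
    using k False assms by (intro scale_mem) auto
  ultimately show ?thesis
    using k(1) assms(2) by (intro mem_gauge_setI) auto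
qed

lemma gauge_set_nonempty: "gauge_set K z \<noteq> {}"
proof -
  obtain r where r: "r > 0" "ball 0 r \<subseteq> K"
    using zero_in_interior mem_interior by blast
  \<comment> \<open>The summand 1 keeps \<open>t\<close> positive at \<open>z = 0\<close> and puts
    \<open>(1 / t) *\<^sub>R z\<close> strictly inside the ball.\<close>
  define t where "t = norm z / r + 1"
  have t: "t > 0" using r by (simp add: t_def add_nonneg_pos)
  have "norm z < t * r" using r by (simp add: t_def field_simps)
  then have "(1 / t) *\<^sub>R z \<in> ball 0 r"
    using t by (simp add: field_simps)
  then have "(1 / t) *\<^sub>R z \<in> K" using r by blast
  moreover have "z = t *\<^sub>R ((1 / t) *\<^sub>R z)" using t by simp
  ultimately have "t \<in> gauge_set K z"
    using t by (intro mem_gauge_setI) auto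
  then show ?thesis by blast
qed

lemma gauge_set_bdd_below: "bdd_below (gauge_set K z)"
  by (auto simp: gauge_set_def intro!: bdd_belowI[of _ 0])

lemma gauge_le: "t \<in> gauge_set K z \<Longrightarrow> minkowski_gauge K z \<le> t"
  unfolding minkowski_gauge_def by (intro cInf_lower gauge_set_bdd_below)

text \<open>The inequality is strict because \<open>K\<close> need not be closed and the infimum
  need not be attained.\<close>

lemma mem_gauge_set:
  assumes "minkowski_gauge K z < s"
  shows "s \<in> gauge_set K z"
proof -
  obtain t where "t \<in> gauge_set K z" "t < s"
    using cInf_lessD[OF gauge_set_nonempty] assms unfolding minkowski_gauge_def by blast
  then show ?thesis using gauge_set_upward by force
qed

lemma gauge_0: "minkowski_gauge K 0 = 0"
proof (rule antisym)
  have "0 \<in> K" using zero_in_interior interior_subset by blast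
  then show "minkowski_gauge K 0 \<le> 0" by (intro gauge_le) (auto simp: gauge_set_def)
  show "0 \<le> minkowski_gauge K 0"
    unfolding minkowski_gauge_def by (intro cInf_greatest gauge_set_nonempty) (auto simp: gauge_set_def)
qed

lemma gauge_scale_le: "minkowski_gauge K (t *\<^sub>R z) \<le> \<bar>t\<bar> * minkowski_gauge K z"
proof (cases "t = 0")
  case True
  then show ?thesis by (simp add: gauge_0)
next
  case False
  have "minkowski_gauge K (t *\<^sub>R z) / \<bar>t\<bar> \<le> s" if s: "minkowski_gauge K z < s" for s
  proof -
    obtain k where k: "0 \<le> s" "k \<in> K" "z = s *\<^sub>R k"
      using mem_gauge_set[OF s] by (auto simp: gauge_set_def)
    \<comment> \<open>Symmetry of \<open>K\<close> absorbs the sign of \<open>t\<close>, leaving a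
      nonnegative parameter.\<close>
    then have "t *\<^sub>R z = (\<bar>t\<bar> * s) *\<^sub>R (sgn t *\<^sub>R k)"
      by (simp add: abs_mult_sgn mult.commute mult.left_commute)
    moreover have "sgn t *\<^sub>R k \<in> K"
      using k by (intro scale_mem) (auto simp: abs_sgn_eq)
    ultimately have "\<bar>t\<bar> * s \<in> gauge_set K (t *\<^sub>R z)"
      using k(1) by (intro mem_gauge_setI) auto
    then show ?thesis
      using gauge_le False by (simp add: field_simps)
  qed
  then have "minkowski_gauge K (t *\<^sub>R z) / \<bar>t\<bar> \<le> minkowski_gauge K z" by (rule dense_ge)
  then show ?thesis using False by (simp add: field_simps)
qed

lemma gauge_scale: "minkowski_gauge K (t *\<^sub>R z) = \<bar>t\<bar> * minkowski_gauge K z"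
proof (cases "t = 0")
  case False
  have "minkowski_gauge K ((1 / t) *\<^sub>R t *\<^sub>R z) \<le> \<bar>1 / t\<bar> * minkowski_gauge K (t *\<^sub>R z)"
    by (rule gauge_scale_le)
  then have "\<bar>t\<bar> * minkowski_gauge K z \<le> minkowski_gauge K (t *\<^sub>R z)"
    using False by (simp add: field_simps)
  with gauge_scale_le[of t z] show ?thesis by simp
qed (simp add: gauge_0)

lemma gauge_triangle: "minkowski_gauge K (x + y) \<le> minkowski_gauge K x + minkowski_gauge K y"
proof (rule field_le_epsilon)
  fix e :: real assume "e > 0"
  define s t where "s = minkowski_gauge K x + e / 2" and "t = minkowski_gauge K y + e / 2"
  have "s \<in> gauge_set K x" "t \<in> gauge_set K y"
    using \<open>e > 0\<close> by (auto simp: s_def t_def intro!: mem_gauge_set)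
  then obtain k l where k: "0 \<le> s" "k \<in> K" "x = s *\<^sub>R k" and l: "0 \<le> t" "l \<in> K" "y = t *\<^sub>R l"
    by (auto simp: gauge_set_def)
  have "s + t \<in> gauge_set K (x + y)"
  proof (cases "s + t = 0")
    case True
    then have "s = 0" "t = 0" using k l by auto
    then show ?thesis using k l by (auto simp: gauge_set_def intro!: image_eqI[of _ _ k])
  next
    case False
    have "(s / (s + t)) *\<^sub>R k + (t / (s + t)) *\<^sub>R l \<in> K"
      using k l False by (intro convexD[OF convex]) (auto simp flip: add_divide_distrib)
    moreover have "x + y = (s + t) *\<^sub>R ((s / (s + t)) *\<^sub>R k + (t / (s + t)) *\<^sub>R l)"
      using k l False by (simp add: scaleR_add_right)
    ultimately show ?thesis
      using k(1) l(1) by (intro mem_gauge_setI) auto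
  qed
  from gauge_le[OF this] show "minkowski_gauge K (x + y) \<le> minkowski_gauge K x + minkowski_gauge K y + e"
    by (simp add: s_def t_def)
qed

lemma bounded_gauge_ball: "bounded {z. minkowski_gauge K z \<le> 1}"
proof (rule bounded_subset)
  \<comment> \<open>A factor above 1 leaves room for boundary points of the ball that are not in
    \<open>K\<close>.\<close>
  show "bounded ((\<lambda>x. 2 *\<^sub>R x) ` K)"
    using bounded by (rule bounded_scaling)
  show "{z. minkowski_gauge K z \<le> 1} \<subseteq> (\<lambda>x. 2 *\<^sub>R x) ` K"
    using mem_gauge_set[of _ 2] by (force simp: gauge_set_def)
qed

sublocale euclidean_norm "minkowski_gauge K"
  by unfold_locales (fact gauge_scale gauge_triangle bounded_gauge_ball)+

text \<open>The ball is closed and contains \<open>K\<close>. Conversely, a point of gauge at most 1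
  is the limit of slightly shrunk copies, which lie in \<open>K\<close>.\<close>

lemma gauge_ball: "{z. minkowski_gauge K z \<le> 1} = closure K"
proof
  have "K \<subseteq> {z. minkowski_gauge K z \<le> 1}"
    by (auto simp: gauge_set_def intro!: gauge_le)
  then show "closure K \<subseteq> {z. minkowski_gauge K z \<le> 1}"
    using compact_imp_closed[OF compact_ball] by (rule closure_minimal)
  show "{z. minkowski_gauge K z \<le> 1} \<subseteq> closure K"
  proof
    fix z assume z: "z \<in> {z. minkowski_gauge K z \<le> 1}"
    have "(1 / (1 + 1 / real (Suc n))) *\<^sub>R z \<in> K" for n
    proof -
      have "1 + 1 / real (Suc n) \<in> gauge_set K z"
        using z by (intro mem_gauge_set) (simp add: add_pos_nonneg order_le_less_trans)
      then obtain k where k: "k \<in> K" "z = (1 + 1 / real (Suc n)) *\<^sub>R k"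
        by (auto simp: gauge_set_def)
      have "1 + 1 / real (Suc n) > 0" by (simp add: add_pos_nonneg)
      then have "(1 / (1 + 1 / real (Suc n))) *\<^sub>R z = k"
        unfolding k(2) by (simp del: of_nat_Suc)
      then show ?thesis using k(1) by simp
    qed
    then have "\<forall>n. (1 / (1 + 1 / real (Suc n))) *\<^sub>R z \<in> K" by blast
    moreover have "(\<lambda>n. (1 / (1 + 1 / real (Suc n))) *\<^sub>R z) \<longlonglongrightarrow> (1 / (1 + 0)) *\<^sub>R z"
      using LIMSEQ_inverse_real_of_nat by (intro tendsto_intros) (auto simp: inverse_eq_divide)
    ultimately have "(1 / (1 + 0)) *\<^sub>R z \<in> closure K"
      unfolding closure_sequential by (intro exI conjI)
    then show "z \<in> closure K" by simp
  qed
qed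

end

section \<open>Finiteness of \<open>K\<close>-distances, and the polygon\<close>

lemma K_dist_eq_Inf: "K_dist K x y = (INF t\<in>gauge_set K (x - y). ereal t)"
  by (simp add: K_dist_def gauge_set_def setcompr_eq_image)

lemma gauge_set_nonempty_of_finite_dist:
  assumes "K_dist K x y \<in> range ereal"
  shows "gauge_set K (x - y) \<noteq> {}"
  using assms by (auto simp: K_dist_eq_Inf top_ereal_def)

text \<open>By symmetry, a \<open>K\<close> with empty interior would lie in a hyperplane through 0.
  Finite distances would then confine \<open>S\<close> to one parallel hyperplane, although it comes
  within \<open>D\<close> of every point.\<close>

lemma interior_nonempty_of_finite_dist:
  assumes "convex K" "\<And>x. x \<in> K \<Longrightarrow> - x \<in> K"
    and D: "D > 0" "\<And>p. \<exists>s\<in>S. dist s p \<le> D"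
    and fin: "\<And>x y. x \<in> S \<Longrightarrow> y \<in> S \<Longrightarrow> K_dist K x y \<in> range ereal"
  shows "interior K \<noteq> {}"
proof
  assume "interior K = {}"
  then obtain a b where a: "a \<noteq> 0" "K \<subseteq> {x. a \<bullet> x = b}"
    using empty_interior_subset_hyperplane[OF \<open>convex K\<close>] by metis
  have orth: "a \<bullet> x = a \<bullet> y" if xy: "x \<in> S" "y \<in> S" for x y
  proof -
    obtain t k where k: "k \<in> K" "x - y = t *\<^sub>R k"
      using gauge_set_nonempty_of_finite_dist[OF fin[OF xy]] by (auto simp: gauge_set_def)
    have "a \<bullet> k = b" "a \<bullet> (- k) = b"
      using a(2) k(1) assms(2)[OF k(1)] by blast+
    then have "a \<bullet> k = 0" by simp
    then have "a \<bullet> (x - y) = 0" using k by simp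
    then show ?thesis by (simp add: inner_diff_right)
  qed
  \<comment> \<open>Points of \<open>S\<close> within \<open>D\<close> of \<open>p\<close> and of 0
    agree under \<open>a\<close>, which allows \<open>p\<close> a height of at most
    \<open>2 * D\<close> in direction \<open>a\<close>; its height is \<open>3 * D\<close>.\<close>
  define p where "p = (3 * D / norm a) *\<^sub>R a"
  obtain s s' where s: "s \<in> S" "dist s p \<le> D" "s' \<in> S" "dist s' 0 \<le> D"
    using D(2) by metis
  have "a \<bullet> p = a \<bullet> s' + a \<bullet> (p - s)"
    using orth[OF s(1,3)] by (simp add: inner_diff_right)
  also have "\<dots> \<le> norm a * norm s' + norm a * norm (p - s)"
    by (intro add_mono norm_cauchy_schwarz)
  also have "\<dots> \<le> norm a * D + norm a * D"
    using s by (intro add_mono mult_left_mono) (auto simp: dist_norm norm_minus_commute)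
  finally have "a \<bullet> p \<le> 2 * D * norm a" by simp
  moreover have "a \<bullet> p = 3 * D * norm a"
    using a(1) by (simp add: p_def dot_square_norm power2_eq_square)
  ultimately show False
    using D(1) a(1) by simp
qed

text \<open>As \<open>K\<close> need not be closed, the polygon is its closure. The condition on
  \<open>range ereal\<close> says that all distances are real numbers.\<close>

theorem theorem0p1:
  fixes K S :: "(real ^ 2) set"
  assumes "bounded K" and "convex K" and "\<forall>x\<in>K. - x \<in> K"
    and "well_distributed S"
    and "K_distance_set K S \<subseteq> range ereal"
    and "uniform_discrete (real_of_ereal ` K_distance_set K S)"
  shows "convex_polygon (closure K) \<and> finite {F. F facet_of closure K}"
proof -
  obtain D where D: "D > 0" "\<And>p. \<exists>s\<in>S. dist s p \<le> D"
    using near_of_well_distributed[OF assms(4)] by blast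
  have fin: "K_dist K x y \<in> range ereal" if "x \<in> S" "y \<in> S" for x y
    using assms(5) that by (auto simp: K_distance_set_def)
  have sym: "- x \<in> K" if "x \<in> K" for x
    using assms(3) that by blast
  interpret symmetric_convex_body K
    using assms(1,2) sym interior_nonempty_of_finite_dist[OF assms(2) sym D fin]
    by (rule symmetric_convex_body.intro)
  have K_dist: "K_dist K x y = ereal (minkowski_gauge K (x - y))" for x y
    unfolding K_dist_eq_Inf minkowski_gauge_def
    by (rule ereal_Inf'[symmetric, OF gauge_set_bdd_below gauge_set_nonempty])
  have mem: "minkowski_gauge K (x - y) \<in> real_of_ereal ` K_distance_set K S" if "x \<in> S" "y \<in> S" for x y
  proof (rule image_eqI)
    show "minkowski_gauge K (x - y) = real_of_ereal (K_dist K x y)"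
      by (simp add: K_dist)
    show "K_dist K x y \<in> K_distance_set K S"
      using that unfolding K_distance_set_def by blast
  qed
  obtain c where c: "c > 0" "\<And>s t. s \<in> real_of_ereal ` K_distance_set K S \<Longrightarrow>
      t \<in> real_of_ereal ` K_distance_set K S \<Longrightarrow> dist s t < c \<Longrightarrow> s = t"
    using assms(6) unfolding uniform_discrete_def by blast
  have "finite {a. a extreme_point_of {z. minkowski_gauge K z \<le> 1}}"
    by (rule finite_extreme_points[OF _ D c(1)]) (simp_all add: c(2) mem dist_real_def)
  then have "finite {a. a extreme_point_of closure K}"
    by (simp add: gauge_ball)
  \<comment> \<open>A compact convex set is the hull of its extreme points, so finitely many of
    these give a polytope.\<close>
  moreover have "closure K = convex hull {a. a extreme_point_of closure K}"
    using Krein_Milman_Minkowski[OF compact_ball convex_ball] by (simp add: gauge_ball)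
  ultimately have "polytope (closure K)"
    unfolding polytope_def by blast
  moreover have "aff_dim (closure K) = 2"
  proof (rule antisym)
    show "aff_dim (closure K) \<le> 2"
      using aff_dim_le_DIM[of "closure K"] by simp
    have "aff_dim (interior K) = 2"
      using aff_dim_open[OF open_interior interior] by simp
    then show "2 \<le> aff_dim (closure K)"
      using aff_dim_subset[of "interior K" "closure K"] interior_subset[of K] closure_subset[of K]
      by auto
  qed
  ultimately show ?thesis
    unfolding convex_polygon_def using finite_polytope_facets by blast
qed

end
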